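(* Let $(X,S)$ be a minimal subshift. Then $X$ has non-superlinear complexity, i.e. $\liminf_{n\to+\infty}p_X(n)/n<+\infty$, if and only if $(X,S)$ is strongly $K$-deconnectable for some integer $K\ge1$.
   Context: $S$ is the shift map, $\mathcal L_n(X)$ is the set of words of length $n$ occurring in elements of $X$, and $p_X(n)=|\mathcal L_n(X)|$. The Rauzy graph of $(X,S)$ at level $n\ge2$ is the directed graph $G_n$ with vertex set $\mathcal L_n(X)$, where $(u_0\cdots u_{n-1},v_0\cdots v_{n-1})$ is an edge if $u_1\cdots u_{n-1}=v_0\cdots v_{n-2}$. For $V'\subset\mathcal L_n(X)$, $G_n[\mathcal L_n(X)\setminus V']$ is the subgraph induced by the vertices not in $V'$. A path in a directed graph is a finite sequence of distinct edges (oriented in the same direction) joining a sequence of distinct vertices; its length is its number of edges. A directed forest is a directed acyclic graph whose underlying undirected graph is a forest (disjoint union of trees). $(X,S)$ is strongly $K$-deconnectable if there exist a strictly increasing sequence of integers $(n_i)_{i\ge1}$, $n_i\ge2$, and a constant $K'\ge1$ such that for all $i\ge1$ there is a subset $V'_{n_i}\subset\mathcal L_{n_i}(X)$ with at most $K$ elements such that every path in $G_{n_i}[\mathcal L_{n_i}(X)\setminus V'_{n_i}]$ has length at most $K'n_i$ and $G_{n_i}[\mathcal L_{n_i}(X)\setminus V'_{n_i}]$ is a directed forest. *)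

theory Defs
  imports "HOL-Analysis.Analysis" "Graph_Theory.Graph_Theory"
begin

definition shift :: "(int \<Rightarrow> 'a) \<Rightarrow> int \<Rightarrow> 'a" where
  "shift x = (\<lambda>i. x (i + 1))"

definition full_shift_topology :: "(int \<Rightarrow> 'a) topology" where
  "full_shift_topology = product_topology (\<lambda>_. discrete_topology UNIV) UNIV"

definition subshift :: "(int \<Rightarrow> 'a::finite) set \<Rightarrow> bool" where
  "subshift X \<longleftrightarrow> closedin full_shift_topology X \<and> shift ` X = X"

(* The closed invariant subsets of X are exactly the subshifts contained in X.
   The empty subshift is not excluded. *)
definition minimal_subshift :: "(int \<Rightarrow> 'a::finite) set \<Rightarrow> bool" where
  "minimal_subshift X \<longleftrightarrow>
     subshift X \<and> (\<forall>Y. Y \<subseteq> X \<and> subshift Y \<longrightarrow> Y = {} \<or> Y = X)"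

definition language :: "(int \<Rightarrow> 'a) set \<Rightarrow> nat \<Rightarrow> 'a list set" where
  "language X n = {map (\<lambda>k. x (i + int k)) [0..<n] | x i. x \<in> X}"

definition complexity :: "(int \<Rightarrow> 'a) set \<Rightarrow> nat \<Rightarrow> nat" where
  "complexity X n = card (language X n)"

definition non_superlinear_complexity :: "(int \<Rightarrow> 'a) set \<Rightarrow> bool" where
  "non_superlinear_complexity X \<longleftrightarrow>
     liminf (\<lambda>n. ereal (real (complexity X n) / real n)) < \<infinity>"

(* An edge (u, v) only requires u and v to be words of X with matching overlap;
   the word u @ [last v] need not itself occur in X. *)
definition rauzy_graph :: "(int \<Rightarrow> 'a) set \<Rightarrow> nat \<Rightarrow> 'a list pair_pre_digraph" where
  "rauzy_graph X n =
     \<lparr> pverts = language X n,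
       parcs = {(u, v). u \<in> language X n \<and> v \<in> language X n \<and> tl u = butlast v} \<rparr>"

(* The library predicate forest excludes directed cycles only (loops and 2-cycles included),
   so it expresses that G is acyclic as a directed graph. Applied to mk_symmetric G it would
   reject every edge, since u, v, u is then a directed cycle; genuine cycles of the underlying
   undirected graph are the cycles of mk_symmetric G of length at least 3. *)
definition directed_forest :: "('v, 'e) pre_digraph \<Rightarrow> bool" where
  "directed_forest G \<longleftrightarrow>
     forest G \<and>
     \<not> (\<exists>p. pre_digraph.cycle (with_proj (mk_symmetric G)) p \<and> 3 \<le> length p)"

(* The distinctness of the vertices required by apath forces the edges to be distinct. *)
definition strongly_deconnectable :: "nat \<Rightarrow> (int \<Rightarrow> 'a) set \<Rightarrow> bool" where
  "strongly_deconnectable K X \<longleftrightarrow>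
     (\<exists>(N :: nat \<Rightarrow> nat) (K' :: real).
        strict_mono N \<and> (\<forall>i. 2 \<le> N i) \<and> 1 \<le> K' \<and>
        (\<forall>i. \<exists>V'. V' \<subseteq> language X (N i) \<and> finite V' \<and> card V' \<le> K \<and>
           (let H = with_proj (rauzy_graph X (N i)) \<restriction> (language X (N i) - V')
            in (\<forall>u p v. pre_digraph.apath H u p v \<longrightarrow> real (length p) \<le> K' * real (N i)) \<and>
               directed_forest H)))"

end

theory Submission
  imports Defs
begin

text \<open>
  If the complexity $p$ satisfies $p(n) \le Cn$ infinitely often, then infinitely often also
  $p(n+1) - p(n) \le 2C$ and $p(n+1) \le 2C(n+1)$. At level $n+1$, delete the boundedly many
  words $u$ for which the word $u$ without its first letter is right special or the word $u$
  without its last letter is left special. All remaining vertices have at most one successor and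
  one predecessor in the whole Rauzy graph, so a cycle avoiding the deleted words would be closed
  under both; by minimality it would contain all words of its length, and $p$ would be bounded.
  (For bounded $p$ one deletes everything.)

  Conversely, the bi-infinite walk given by a point of $X$ has to meet the deleted set $V'$ in both
  directions, so every word outside $V'$ lies on a walk in the forest from a successor of $V'$ to a
  predecessor of $V'$. Such a walk is determined by its ends, of which there are boundedly many,
  and it has $O(n)$ vertices.
\<close>

section \<open>Cycles and walks as vertex lists\<close>

text \<open>Induced subgraphs of Rauzy graphs have this form, and so do their symmetrizations, with
  \<open>symclp R\<close> in place of \<open>R\<close>. The graph-theoretic notions thus reduce to
  statements about one relation on lists.\<close>

definition rel_digraph :: "'v set \<Rightarrow> ('v \<Rightarrow> 'v \<Rightarrow> bool) \<Rightarrow> 'v pair_pre_digraph" where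
  "rel_digraph V R = \<lparr> pverts = V, parcs = {(u, v). u \<in> V \<and> v \<in> V \<and> R u v} \<rparr>"

text \<open>The pair \<^term>\<open>(last vs, hd vs)\<close> is the closing step of the cycle.\<close>

definition cyclic_list :: "('v \<Rightarrow> 'v \<Rightarrow> bool) \<Rightarrow> 'v list \<Rightarrow> bool" where
  "cyclic_list R vs \<longleftrightarrow> vs \<noteq> [] \<and> distinct vs \<and> successively R (last vs # vs)"

lemma rel_digraph_simps [simp]:
  "pverts (rel_digraph V R) = V"
  "parcs (rel_digraph V R) = {(u, v). u \<in> V \<and> v \<in> V \<and> R u v}"
  by (simp_all add: rel_digraph_def)

lemma mk_symmetric_rel_digraph:
  "mk_symmetric (with_proj (rel_digraph V R)) = rel_digraph V (symclp R)"
  by (auto simp: mk_symmetric_def rel_digraph_def symclp_pointfree sup_fun_def)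

lemma induce_rauzy_graph:
  assumes "V \<subseteq> language X n"
  shows "with_proj (rauzy_graph X n) \<restriction> V = with_proj (rel_digraph V (\<lambda>u v. tl u = butlast v))"
  using assms by (auto simp: induce_subgraph_def rauzy_graph_def with_proj_def rel_digraph_def)

text \<open>Arcs are pairs of vertices, so the arc list of a walk is the list of its consecutive
  pairs; a single vertex gives the empty arc list.\<close>

lemma awalk_of_vertices:
  assumes "vs \<noteq> []" "set vs \<subseteq> V" "successively R vs"
  shows "pre_digraph.awalk (with_proj (rel_digraph V R)) (hd vs) (zip vs (tl vs)) (last vs)"
    and "pawalk_verts (hd vs) (zip vs (tl vs)) = vs"
proof -
  have "set (zip vs (tl vs)) \<subseteq> parcs (rel_digraph V R) \<and> pcas (hd vs) (zip vs (tl vs)) (last vs)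
     \<and> pawalk_verts (hd vs) (zip vs (tl vs)) = vs"
    using assms
  proof (induction vs)
    case (Cons a vs)
    then show ?case by (cases vs) auto
  qed simp
  then show "pawalk_verts (hd vs) (zip vs (tl vs)) = vs"
    "pre_digraph.awalk (with_proj (rel_digraph V R)) (hd vs) (zip vs (tl vs)) (last vs)"
    using assms(1,2) hd_in_set[of vs]
    by (auto simp: pre_digraph.awalk_def cas_with_proj_eq simp del: hd_in_set)
qed

lemma awalk_vertices:
  assumes "pre_digraph.awalk (with_proj (rel_digraph V R)) u p v"
  shows "set (pawalk_verts u p) \<subseteq> V" "successively R (pawalk_verts u p)"
    "hd (pawalk_verts u p) = u" "last (pawalk_verts u p) = v"
    "length (pawalk_verts u p) = Suc (length p)"
proof -
  have "u \<in> V" "set p \<subseteq> parcs (rel_digraph V R)" "pcas u p v"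
    using assms by (auto simp: pre_digraph.awalk_def cas_with_proj_eq)
  then have "set (pawalk_verts u p) \<subseteq> V \<and> successively R (pawalk_verts u p) \<and>
    hd (pawalk_verts u p) = u \<and> last (pawalk_verts u p) = v \<and>
    length (pawalk_verts u p) = Suc (length p)"
  proof (induction p arbitrary: u)
    case (Cons e p)
    then have "pawalk_verts (snd e) p \<noteq> []" by (cases p) auto
    moreover have "snd e \<in> V" "fst e = u" "R u (snd e)" "set p \<subseteq> parcs (rel_digraph V R)"
      "pcas (snd e) p v" using Cons.prems by auto
    ultimately show ?case
      using Cons.IH[of "snd e"] Cons.prems(1) by (simp add: successively_Cons)
  qed simp
  then show "set (pawalk_verts u p) \<subseteq> V" "successively R (pawalk_verts u p)"
    "hd (pawalk_verts u p) = u" "last (pawalk_verts u p) = v"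
    "length (pawalk_verts u p) = Suc (length p)" by auto
qed

text \<open>The vertex list of a cycle has the form \<open>u # vs\<close> with
  \<open>last vs = u\<close> and only \<open>u\<close> repeated. Dropping the first \<open>u\<close>
  gives a cyclic list with as many entries as the cycle has arcs; loops become singletons.\<close>

lemma cycle_rel_digraph_iff:
  "(\<exists>p. pre_digraph.cycle (with_proj (rel_digraph V R)) p \<and> k \<le> length p) \<longleftrightarrow>
   (\<exists>vs. cyclic_list R vs \<and> set vs \<subseteq> V \<and> k \<le> length vs)"
proof
  assume "\<exists>p. pre_digraph.cycle (with_proj (rel_digraph V R)) p \<and> k \<le> length p"
  then obtain p u where w: "pre_digraph.awalk (with_proj (rel_digraph V R)) u p u"
    and d: "distinct (tl (pawalk_verts u p))" and "p \<noteq> []" "k \<le> length p"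
    by (auto simp: pre_digraph.cycle_def awalk_verts_with_proj_eq)
  note vw = awalk_vertices[OF w]
  obtain vs where vs: "pawalk_verts u p = u # vs" "length vs = length p"
    using vw(3,5) by (cases "pawalk_verts u p") auto
  with \<open>p \<noteq> []\<close> have "vs \<noteq> []" by auto
  with vs vw d have "cyclic_list R vs" "set vs \<subseteq> V" by (auto simp: cyclic_list_def)
  with vs \<open>k \<le> length p\<close> show "\<exists>vs. cyclic_list R vs \<and> set vs \<subseteq> V \<and> k \<le> length vs" by auto
next
  assume "\<exists>vs. cyclic_list R vs \<and> set vs \<subseteq> V \<and> k \<le> length vs"
  then obtain vs where vs: "vs \<noteq> []" "distinct vs" "successively R (last vs # vs)"
    "set vs \<subseteq> V" "k \<le> length vs" by (auto simp: cyclic_list_def)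
  let ?p = "zip (last vs # vs) vs"
  have "set (last vs # vs) \<subseteq> V" using vs(1,4) by auto
  note w = awalk_of_vertices[OF _ this vs(3), simplified]
  have "pre_digraph.cycle (with_proj (rel_digraph V R)) ?p"
    using w vs(1,2) by (cases vs) (auto simp: pre_digraph.cycle_def awalk_verts_with_proj_eq)
  moreover have "length ?p = length vs" by simp
  ultimately show "\<exists>p. pre_digraph.cycle (with_proj (rel_digraph V R)) p \<and> k \<le> length p"
    using vs(5) by metis
qed

lemma directed_forest_rel_digraph_iff:
  "directed_forest (with_proj (rel_digraph V R)) \<longleftrightarrow>
   \<not> (\<exists>vs. cyclic_list R vs \<and> set vs \<subseteq> V) \<and>
   \<not> (\<exists>vs. cyclic_list (symclp R) vs \<and> set vs \<subseteq> V \<and> 3 \<le> length vs)"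
  unfolding directed_forest_def forest_def mk_symmetric_rel_digraph cycle_rel_digraph_iff
  using cycle_rel_digraph_iff[of V R 0] by simp

lemma apath_rel_digraph_iff:
  "(\<forall>u p v. pre_digraph.apath (with_proj (rel_digraph V R)) u p v \<longrightarrow> Q (length p)) \<longleftrightarrow>
   (\<forall>vs. vs \<noteq> [] \<and> set vs \<subseteq> V \<and> distinct vs \<and> successively R vs \<longrightarrow> Q (length vs - 1))"
  (is "?L \<longleftrightarrow> ?R")
proof
  assume L: ?L
  show ?R
  proof safe
    fix vs assume vs: "vs \<noteq> []" "set vs \<subseteq> V" "distinct vs" "successively R vs"
    then have "pre_digraph.apath (with_proj (rel_digraph V R)) (hd vs) (zip vs (tl vs)) (last vs)"
      using awalk_of_vertices[OF vs(1,2,4)]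
      by (simp add: pre_digraph.apath_def awalk_verts_with_proj_eq)
    with L have "Q (length (zip vs (tl vs)))" by blast
    then show "Q (length vs - 1)" by simp
  qed
next
  assume R: ?R
  show ?L
  proof safe
    fix u p v assume "pre_digraph.apath (with_proj (rel_digraph V R)) u p v"
    then have w: "pre_digraph.awalk (with_proj (rel_digraph V R)) u p v"
      "distinct (pawalk_verts u p)"
      by (auto simp: pre_digraph.apath_def awalk_verts_with_proj_eq)
    have "pawalk_verts u p \<noteq> []" by (cases p) auto
    with R w awalk_vertices[OF w(1)] have "Q (length (pawalk_verts u p) - 1)" by blast
    then show "Q (length p)" using awalk_vertices(5)[OF w(1)] by simp
  qed
qed

section \<open>Repetitions, cycles and uniqueness of walks\<close>

lemma successively_append_Cons:
  "successively P (xs @ z # ys) \<longleftrightarrow> successively P (xs @ [z]) \<and> successively P (z # ys)"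
  by (auto simp: successively_append_iff successively_Cons)

lemma cyclic_list_rotate:
  assumes "cyclic_list R (xs @ ys)"
  shows "cyclic_list R (ys @ xs)"
proof (cases "xs = [] \<or> ys = []")
  case False
  then show ?thesis using assms
    by (auto simp: cyclic_list_def successively_Cons successively_append_iff)
qed (use assms in auto)

text \<open>Rotate \<open>v\<close> to the front: \<open>b\<close> is then the second entry and
  \<open>a\<close> the last one, and these differ once there are three entries.\<close>

lemma cyclic_list_neighbours:
  assumes "cyclic_list R vs" "v \<in> set vs"
  obtains a b where "a \<in> set vs" "b \<in> set vs" "R a v" "R v b" "3 \<le> length vs \<Longrightarrow> a \<noteq> b"
proof -
  obtain xs ys where vs: "vs = xs @ v # ys" using assms(2) by (meson split_list)
  then have c: "cyclic_list R (v # ys @ xs)" using assms(1) cyclic_list_rotate[of R xs "v # ys"] by simp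
  show ?thesis
  proof (cases "ys @ xs")
    case Nil
    then show ?thesis using that[of v v] c vs by (simp add: cyclic_list_def)
  next
    case (Cons b zs)
    have mem: "set (ys @ xs) \<subseteq> set vs" using vs by auto
    have "b \<in> set vs" "last (b # zs) \<in> set vs"
      using mem unfolding Cons by (metis list.set_intros(1) subsetD last_in_set list.distinct(1))+
    moreover have "R (last (b # zs)) v" "R v b"
      using c unfolding Cons by (auto simp: cyclic_list_def)
    moreover have "last (b # zs) \<noteq> b" if "3 \<le> length vs"
    proof -
      have "length (b # zs) = length vs - 1" unfolding Cons[symmetric] using vs by simp
      then have "zs \<noteq> []" using that by auto
      then show ?thesis using c unfolding Cons by (auto simp: cyclic_list_def)
    qed
    ultimately show ?thesis using that by blast
  qed
qed

text \<open>Between two visits to \<open>y\<close> the walk closes up. Either \<open>y # bs\<close>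
  has no repetition and yields the cycle, or it is a shorter walk with a repetition.\<close>

lemma not_distinct_walk_imp_cyclic_list:
  assumes "successively R xs" "\<not> distinct xs"
  shows "\<exists>vs. cyclic_list R vs \<and> set vs \<subseteq> set xs"
  using assms
proof (induction xs rule: length_induct)
  case (1 xs)
  obtain as bs cs y where xs: "xs = as @ [y] @ bs @ [y] @ cs"
    using not_distinct_decomp[OF 1(3)] by blast
  have "successively R (as @ y # (bs @ y # cs))" using 1(2) xs by simp
  then have "successively R ((y # bs) @ y # cs)" by (subst (asm) successively_append_Cons) simp
  then have "successively R ((y # bs) @ [y])" by (subst (asm) successively_append_Cons) simp
  show ?case
  proof (cases "distinct (y # bs)")
    case True
    then have "cyclic_list R (bs @ [y])"
      using \<open>successively R ((y # bs) @ [y])\<close> by (simp add: cyclic_list_def)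
    then show ?thesis using xs by (intro exI[of _ "bs @ [y]"]) auto
  next
    case False
    moreover have "successively R (y # bs)"
      using \<open>successively R ((y # bs) @ [y])\<close> unfolding successively_append_iff by blast
    moreover have "length (y # bs) < length xs" using xs by simp
    ultimately obtain vs where "cyclic_list R vs" "set vs \<subseteq> set (y # bs)" using 1(1) by blast
    then show ?thesis using xs by (intro exI[of _ vs]) auto
  qed
qed

text \<open>Two different walks with common ends enclose a cycle of the underlying undirected graph,
  formed between the point where they split and the next point where they meet.\<close>

lemma unique_walk:
  assumes "\<And>zs. cyclic_list (symclp R) zs \<Longrightarrow> set zs \<subseteq> V \<Longrightarrow> length zs < 3"
    and "set xs \<subseteq> V" "set ys \<subseteq> V" "distinct xs" "distinct ys"
    and "successively R xs" "successively R ys" "xs \<noteq> []" "ys \<noteq> []"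
    and "hd xs = hd ys" "last xs = last ys"
  shows "xs = ys"
  using assms(2-)
proof (induction xs arbitrary: ys)
  case (Cons s xs)
  obtain ys' where ys: "ys = s # ys'" using Cons.prems by (cases ys) auto
  show ?case
  proof (cases "xs = [] \<or> ys' = []")
    case True
    have "xs = []" if "ys' = []" using that Cons.prems ys by (auto split: if_splits)
    moreover have "ys' = []" if "xs = []" using that Cons.prems ys by (auto split: if_splits)
    ultimately show ?thesis using ys True by auto
  next
    case ne: False
    show ?thesis
    proof (cases "hd xs = hd ys'")
      case True
      have "xs = ys'"
        using Cons.IH[of ys'] Cons.prems ys ne True by (auto simp: successively_Cons)
      then show ?thesis using ys by simp
    next
      case False
      \<comment> \<open>Both remainders are nonempty and end in the same vertex, so they
        meet.\<close>
      have "\<exists>x\<in>set xs. x \<in> set ys'"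
        using Cons.prems(10) ys ne by (metis last_ConsR last_in_set)
      then obtain p c q where xs: "xs = p @ c # q" and c: "c \<in> set ys'"
        and p: "\<forall>x\<in>set p. x \<notin> set ys'" 
        by (rule split_list_first_propE)
      obtain p' q' where ys': "ys' = p' @ c # q'" using c by (meson split_list)
      txt \<open>After the first step the walks split, and \<open>c\<close> is where the first one meets the second.\<close>
      let ?zs = "s # p @ c # rev p'"
      have "successively R ((s # p @ [c]) @ q)" "successively R ((s # p' @ [c]) @ q')"
        using Cons.prems ys xs ys' by simp_all
      then have "successively R (s # p @ [c])" "successively R (s # p' @ [c])"
        unfolding successively_append_iff by blast+
      \<comment> \<open>The second branch is run backwards from \<open>c\<close> to
        \<open>s\<close>, which only the symmetric closure permits.\<close>
      then have "successively R (s # p @ [c])" "successively (\<lambda>x y. R y x) (rev (s # p' @ [c]))"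
        by (simp_all only: successively_rev)
      then have "successively (symclp R) (s # p @ [c])" "successively (symclp R) (c # rev p' @ [s])"
        by (auto elim!: successively_mono simp: symclp_def)
      then have "successively (symclp R) ((s # p) @ c # rev p' @ [s])"
        by (subst successively_append_Cons) simp
      then have "successively (symclp R) (?zs @ [s])"
        by (simp only: append_Cons append_assoc append_Nil)
      then have "successively (symclp R) ?zs" "symclp R (last ?zs) s"
        by (simp_all only: successively_append_iff list.distinct list.sel simp_thms)
      then have "successively (symclp R) (last ?zs # ?zs)"
        by (simp only: successively_Cons list.sel simp_thms)
      moreover have "distinct ?zs"
        using Cons.prems ys xs ys' p by auto
      ultimately have "cyclic_list (symclp R) ?zs" by (simp add: cyclic_list_def)
      moreover have "set ?zs \<subseteq> V" using Cons.prems ys xs ys' by auto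
      \<comment> \<open>If \<open>p\<close> and \<open>p'\<close> were both empty, both walks would
        step from \<open>s\<close> to \<open>c\<close>; but their second vertices differ.\<close>
      moreover have "length ?zs \<ge> 3"
        using False xs ys' by (cases p; cases p') auto
      ultimately show ?thesis using assms(1)[of ?zs] by linarith
    qed
  qed
qed simp

section \<open>Words and complexity\<close>

definition window :: "(int \<Rightarrow> 'a) \<Rightarrow> int \<Rightarrow> nat \<Rightarrow> 'a list" where
  "window x i n = map (\<lambda>k. x (i + int k)) [0..<n]"

lemma language_eq_windows: "language X n = {window x i n | x i. x \<in> X}"
  by (simp add: language_def window_def)

lemma length_window [simp]: "length (window x i n) = n"
  by (simp add: window_def)

lemma window_nth [simp]: "k < n \<Longrightarrow> window x i n ! k = x (i + int k)"
  by (simp add: window_def)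

lemma window_in_language: "x \<in> X \<Longrightarrow> window x i n \<in> language X n"
  by (auto simp: language_eq_windows)

lemma length_language: "u \<in> language X n \<Longrightarrow> length u = n"
  by (auto simp: language_eq_windows)

lemma finite_language [simp, intro]: "finite (language (X :: (int \<Rightarrow> 'a::finite) set) n)"
  by (rule finite_subset[OF _ finite_lists_length_eq[of UNIV n]]) (auto simp: length_language)

lemma butlast_window: "butlast (window x i (Suc n)) = window x i n"
  by (intro nth_equalityI) (auto simp: nth_butlast)

lemma tl_window: "tl (window x i (Suc n)) = window x (i + 1) n"
  by (intro nth_equalityI) (auto simp: nth_tl algebra_simps)

lemma window_shift: "window (shift x) i n = window x (i + 1) n"
  by (intro nth_equalityI) (auto simp: shift_def algebra_simps)

lemma window_step: "1 \<le> n \<Longrightarrow> tl (window x i n) = butlast (window x (i + 1) n)"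
  by (cases n) (simp_all add: butlast_window tl_window)

lemma butlast_language: "butlast ` language X (Suc n) = language X n"
  by (force simp: language_eq_windows butlast_window image_iff)

lemma tl_language: "tl ` language X (Suc n) = language X n"
proof
  show "language X n \<subseteq> tl ` language X (Suc n)"
  proof
    fix u assume "u \<in> language X n"
    then obtain x i where "x \<in> X" "u = window x i n" by (auto simp: language_eq_windows)
    then have "u = tl (window x (i - 1) (Suc n))" by (simp add: tl_window)
    then show "u \<in> tl ` language X (Suc n)" using window_in_language[OF \<open>x \<in> X\<close>] by blast
  qed
  show "tl ` language X (Suc n) \<subseteq> language X n"
    by (auto simp: language_eq_windows tl_window) blast
qed

section \<open>Growth of the complexity and counting of extensions\<close>

lemma complexity_Suc_ge: "complexity X n \<le> complexity X (Suc n)"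
  for X :: "(int \<Rightarrow> 'a::finite) set"
  unfolding complexity_def by (metis butlast_language card_image_le finite_language)

lemma complexity_mono: "m \<le> n \<Longrightarrow> complexity X m \<le> complexity X n"
  for X :: "(int \<Rightarrow> 'a::finite) set"
  by (rule lift_Suc_mono_le[of "complexity X"]) (auto intro: complexity_Suc_ge)

text \<open>Besides one chosen preimage of each value, every value with several preimages supplies
  another element of \<open>A\<close>. With \<open>butlast\<close> or \<open>tl\<close> for
  \<open>f\<close>, this bounds the number of right or left special words of length \<open>n\<close>
  by the increment of the complexity.\<close>

lemma card_multiple_fibres:
  assumes "finite A"
  shows "card {b. \<exists>a\<in>A. \<exists>a'\<in>A. a \<noteq> a' \<and> f a = b \<and> f a' = b} + card (f ` A) \<le> card A"
proof -
  define D where "D = {b. \<exists>a\<in>A. \<exists>a'\<in>A. a \<noteq> a' \<and> f a = b \<and> f a' = b}"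
  let ?g = "inv_into A f"
  have "\<forall>b\<in>D. \<exists>a. a \<in> A \<and> f a = b \<and> a \<noteq> ?g b"
  proof
    fix b assume "b \<in> D"
    then obtain a a' where "a \<in> A" "a' \<in> A" "a \<noteq> a'" "f a = b" "f a' = b" unfolding D_def by auto
    then show "\<exists>a. a \<in> A \<and> f a = b \<and> a \<noteq> ?g b" by metis
  qed
  from bchoice[OF this] obtain h where h: "\<forall>b\<in>D. h b \<in> A \<and> f (h b) = b \<and> h b \<noteq> ?g b" by blast
  have g: "?g b \<in> A" "f (?g b) = b" if "b \<in> f ` A" for b
    using that by (simp_all add: inv_into_into f_inv_into_f)
  have "inj_on h D" by (rule inj_onI) (metis h)
  moreover have "inj_on ?g (f ` A)" by (rule inj_on_inv_into) simp
  moreover have "h ` D \<inter> ?g ` f ` A = {}"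
  proof -
    have False if "b \<in> D" "c \<in> f ` A" "h b = ?g c" for b c
      using that h g(2)[OF that(2)] by metis
    then show ?thesis by blast
  qed
  moreover have "finite (f ` A)" "D \<subseteq> f ` A" using assms by (auto simp: D_def)
  moreover from this have "finite D" by (rule finite_subset[rotated])
  ultimately have "card D + card (f ` A) = card (h ` D \<union> ?g ` f ` A)"
    by (simp add: card_Un_disjoint card_image)
  also have "\<dots> \<le> card A" using h g(1) assms by (intro card_mono) auto
  finally show ?thesis unfolding D_def .
qed

lemma card_tl_vimage_le:
  assumes "finite W" "\<And>u. u \<in> U \<Longrightarrow> u \<noteq> [] \<and> tl u \<in> W"
  shows "card (U :: 'a::finite list set) \<le> CARD('a) * card W"
proof -
  have "U \<subseteq> (\<lambda>(a, w). a # w) ` (UNIV \<times> W)"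
  proof
    fix u assume "u \<in> U"
    then have "u = hd u # tl u" "tl u \<in> W" using assms(2) by auto
    then show "u \<in> (\<lambda>(a, w). a # w) ` (UNIV \<times> W)" by (intro image_eqI[of _ _ "(hd u, tl u)"]) auto
  qed
  then have "card U \<le> card ((UNIV :: 'a set) \<times> W)"
    using assms(1) by (meson finite_SigmaI finite_class.finite_UNIV surj_card_le)
  then show ?thesis by (simp add: card_cartesian_product)
qed

text \<open>Reversal of words turns \<open>butlast\<close> into \<open>tl\<close>.\<close>

lemma card_butlast_vimage_le:
  assumes "finite W" "\<And>u. u \<in> U \<Longrightarrow> u \<noteq> [] \<and> butlast u \<in> W"
  shows "card (U :: 'a::finite list set) \<le> CARD('a) * card W"
proof -
  have "card U = card (rev ` U)" by (simp add: card_image)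
  also have "\<dots> \<le> CARD('a) * card (rev ` W)"
  proof (rule card_tl_vimage_le)
    fix u assume "u \<in> rev ` U"
    then obtain w where w: "w \<in> U" "u = rev w" by blast
    have "butlast w = rev (tl u)" using butlast_rev[of u] w(2) by simp
    then have "tl u = rev (butlast w)" by simp
    then show "u \<noteq> [] \<and> tl u \<in> rev ` W" using assms(2)[OF w(1)] w(2) by simp
  qed (use assms in simp)
  finally show ?thesis by (simp add: card_image)
qed

text \<open>A sequence has infinite liminf exactly when it tends to infinity. Otherwise some real
  bound holds infinitely often, and it can be rounded up to a positive integer.\<close>

lemma non_superlinear_complexity_iff:
  "non_superlinear_complexity X \<longleftrightarrow>
   (\<exists>C\<ge>1::nat. \<forall>m. \<exists>n\<ge>m. complexity X n \<le> C * n)"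
proof -
  let ?f = "\<lambda>n. ereal (real (complexity X n) / real n)"
  have "non_superlinear_complexity X \<longleftrightarrow> \<not> (?f \<longlonglongrightarrow> \<infinity>)"
    by (simp add: non_superlinear_complexity_def Liminf_PInfty less_top[symmetric] top_ereal_def)
  also have "\<dots> \<longleftrightarrow> (\<exists>r. \<forall>m. \<exists>n\<ge>m. real (complexity X n) / real n \<le> r)"
    by (simp add: tendsto_PInfty eventually_sequentially not_less)
  also have "\<dots> \<longleftrightarrow> (\<exists>C\<ge>1::nat. \<forall>m. \<exists>n\<ge>m. complexity X n \<le> C * n)" (is "?L \<longleftrightarrow> ?R")
  proof
    assume ?L
    then obtain r where r: "\<And>m. \<exists>n\<ge>m. real (complexity X n) / real n \<le> r" by blast
    define C where "C = max 1 (nat \<lceil>r\<rceil>)"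
    have "r \<le> real C" unfolding C_def by linarith
    have "\<exists>n\<ge>m. complexity X n \<le> C * n" for m
    proof -
      \<comment> \<open>At \<open>n = 0\<close> the quotient is 0 by convention and says nothing
        about the complexity.\<close>
      obtain n where n: "n \<ge> max 1 m" "real (complexity X n) / real n \<le> r" using r by blast
      then have "real (complexity X n) \<le> r * real n" by (simp add: field_simps)
      also have "\<dots> \<le> real C * real n" using \<open>r \<le> real C\<close> by (simp add: mult_right_mono)
      finally have "complexity X n \<le> C * n" by (metis of_nat_le_iff of_nat_mult)
      then show ?thesis using n by auto
    qed
    then show ?R by (intro exI[of _ C]) (auto simp: C_def)
  next
    assume ?R
    then obtain C :: nat where C: "\<And>m. \<exists>n\<ge>m. complexity X n \<le> C * n" by blast
    have "\<exists>n\<ge>m. real (complexity X n) / real n \<le> real C" for m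
    proof -
      obtain n where n: "n \<ge> max 1 m" "complexity X n \<le> C * n" using C by blast
      then have "real (complexity X n) \<le> real C * real n" by (metis of_nat_le_iff of_nat_mult)
      then show ?thesis using n by (intro exI[of _ n]) (auto simp: field_simps)
    qed
    then show ?L by blast
  qed
  finally show ?thesis .
qed

text \<open>Pigeonhole on the upper half of \<open>{0..<m}\<close>: if every increment there
  exceeded \<open>2 * C\<close>, then \<open>p m\<close> would exceed \<open>C * m\<close>. As the
  index found is at least about \<open>m / 2\<close>, the bound at \<open>m\<close> also gives a
  linear bound at that index, with twice the constant.\<close>

lemma small_increment:
  fixes p :: "nat \<Rightarrow> nat"
  assumes "mono p" "\<And>m. \<exists>n\<ge>m. p n \<le> C * n"
  shows "\<exists>n\<ge>M. p (Suc n) \<le> p n + 2 * C \<and> p (Suc n) \<le> 2 * C * Suc n"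
proof -
  \<comment> \<open>This puts \<open>m div 2\<close> above \<open>M\<close> and makes the upper half
    nonempty.\<close>
  obtain m where m: "m \<ge> 2 * M + 2" "p m \<le> C * m" using assms(2) by blast
  have "\<exists>n\<in>{m div 2..<m}. p (Suc n) \<le> p n + 2 * C"
  proof (rule ccontr)
    assume no: "\<not> (\<exists>n\<in>{m div 2..<m}. p (Suc n) \<le> p n + 2 * C)"
    have big: "p n + 2 * C + 1 \<le> p (Suc n)" if "m div 2 \<le> n" "n < m" for n
    proof -
      have "\<not> p (Suc n) \<le> p n + 2 * C" using no that by auto
      then show ?thesis by simp
    qed
    have grow: "k * (2 * C + 1) \<le> p (m div 2 + k)" if "m div 2 + k \<le> m" for k
      using that
    proof (induction k)
      case (Suc k)
      then show ?case using big[of "m div 2 + k"] by simp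
    qed simp
    define d where "d = m - m div 2"
    have "d * (2 * C + 1) \<le> p m"
      using grow[of d] by (simp add: d_def)
    \<comment> \<open>Since \<open>2 * d\<close> is at least \<open>m\<close>, the first summand
      already reaches \<open>C * m\<close>, and the extra \<open>d\<close> gives the
      contradiction.\<close>
    moreover have "d * (2 * C + 1) = C * (2 * d) + d" by (simp add: algebra_simps)
    moreover have "C * m \<le> C * (2 * d)" by (intro mult_left_mono) (auto simp: d_def)
    moreover have "d \<ge> 1" using m by (auto simp: d_def)
    ultimately show False using m(2) by linarith
  qed
  then obtain n where n: "m div 2 \<le> n" "n < m" "p (Suc n) \<le> p n + 2 * C" by auto
  have "p (Suc n) \<le> C * m" using monoD[OF assms(1), of "Suc n" m] n m(2) by simp
  also have "\<dots> \<le> C * (2 * Suc n)" using n by (intro mult_left_mono) auto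
  finally show ?thesis using n m by (intro exI[of _ n]) auto
qed

section \<open>Deconnecting sets\<close>

text \<open>Only finitely many coordinates are read, so the cylinder fixing them is a neighbourhood
  inside the set. As \<open>Q\<close> is arbitrary, the complement is open too.\<close>

lemma openin_window: "openin full_shift_topology {y. Q (window y i n)}"
proof (subst openin_subopen, intro ballI)
  fix y assume y: "y \<in> {y. Q (window y i n)}"
  let ?I = "{i..<i + int n}"
  let ?T = "Pi\<^sub>E UNIV (\<lambda>j. if j \<in> ?I then {y j} else UNIV)"
  have "openin full_shift_topology ?T"
    unfolding full_shift_topology_def
  proof (rule product_topology_basis)
    show "finite {j. (if j \<in> ?I then {y j} else UNIV) \<noteq> topspace (discrete_topology UNIV)}"
      by (rule finite_subset[of _ ?I]) auto
  qed auto
  moreover have "y \<in> ?T" by auto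
  moreover have "?T \<subseteq> {y. Q (window y i n)}"
  proof
    fix z assume "z \<in> ?T"
    then have "window z i n = window y i n"
      by (intro nth_equalityI) (auto simp: PiE_iff split: if_splits dest!: spec)
    then show "z \<in> {y. Q (window y i n)}" using y by simp
  qed
  ultimately show "\<exists>T. openin full_shift_topology T \<and> y \<in> T \<and> T \<subseteq> {y. Q (window y i n)}" by blast
qed

text \<open>This is the intersection of \<open>X\<close> with the subshift of finite type whose
  allowed words of length \<open>n\<close> are those in \<open>C\<close>.\<close>

lemma subshift_windows_in:
  assumes "subshift X"
  shows "subshift {y \<in> X. \<forall>i. window y i n \<in> C}" (is "subshift ?Y")
proof -
  have top: "topspace full_shift_topology = UNIV" by (simp add: full_shift_topology_def)
  have "closedin full_shift_topology {y. window y i n \<in> C}" for i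
    using openin_window[of "\<lambda>w. w \<notin> C" i n] by (simp add: closedin_def top Compl_eq_Diff_UNIV[symmetric] Collect_neg_eq[symmetric])
  then have "closedin full_shift_topology (X \<inter> (\<Inter>i. {y. window y i n \<in> C}))"
    using assms by (intro closedin_Int closedin_Inter) (auto simp: subshift_def)
  moreover have "X \<inter> (\<Inter>i. {y. window y i n \<in> C}) = ?Y" by auto
  moreover have "shift ` ?Y = ?Y"
  proof
    show "shift ` ?Y \<subseteq> ?Y" using assms by (auto simp: subshift_def window_shift)
    show "?Y \<subseteq> shift ` ?Y"
    proof
      fix y assume y: "y \<in> ?Y"
      then obtain x where x: "x \<in> X" "y = shift x" using assms by (auto simp: subshift_def)
      have "window x i n \<in> C" for i
      proof -
        have "window y (i - 1) n \<in> C" using y by blast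
        then show ?thesis by (simp add: x(2) window_shift)
      qed
      then show "y \<in> shift ` ?Y" using x by blast
    qed
  qed
  ultimately show ?thesis by (simp add: subshift_def)
qed

text \<open>A point with one window in \<open>C\<close> has all its windows in \<open>C\<close>, by
  moving along the Rauzy graph in both directions. So the points with all windows in
  \<open>C\<close> form a nonempty subshift of \<open>X\<close>, which by minimality is
  \<open>X\<close>.\<close>

lemma minimal_closed_set_of_words:
  assumes X: "minimal_subshift X" and "1 \<le> n" "C \<subseteq> language X n" "C \<noteq> {}"
    and succ: "\<And>u v. u \<in> C \<Longrightarrow> v \<in> language X n \<Longrightarrow> tl u = butlast v \<Longrightarrow> v \<in> C"
    and pred: "\<And>u v. v \<in> C \<Longrightarrow> u \<in> language X n \<Longrightarrow> tl u = butlast v \<Longrightarrow> u \<in> C"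
  shows "C = language X n"
proof -
  define Y where "Y = {y \<in> X. \<forall>i. window y i n \<in> C}"
  obtain x i where x: "x \<in> X" "window x i n \<in> C"
    using assms(3,4) by (fastforce simp: language_eq_windows)
  have "window x j n \<in> C" for j
  proof (induction j rule: int_induct[where k = i])
    case (step1 j)
    then show ?case using succ window_step[OF \<open>1 \<le> n\<close>] window_in_language[OF x(1)] by blast
  next
    case (step2 j)
    then show ?case
      using pred window_step[OF \<open>1 \<le> n\<close>, of x "j - 1"] window_in_language[OF x(1)] by force
  qed (rule x(2))
  then have "Y \<noteq> {}" using x(1) by (auto simp: Y_def)
  moreover have "subshift Y" unfolding Y_def using X by (intro subshift_windows_in) (simp add: minimal_subshift_def)
  moreover have "Y \<subseteq> X" by (auto simp: Y_def)
  ultimately have "Y = X" using X unfolding minimal_subshift_def by blast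
  then have "language X n \<subseteq> C" by (auto simp: language_eq_windows Y_def)
  then show ?thesis using assms(3) by blast
qed

text \<open>The last \<open>n\<close> letters of a word of length at least \<open>n\<close>
  determine the letter that follows, so each such word extends to the right in one way and the
  complexity is constant from \<open>n\<close> on.\<close>

lemma complexity_bounded_of_unique_successors:
  fixes X :: "(int \<Rightarrow> 'a::finite) set"
  assumes "1 \<le> n"
    and uniq: "\<And>u v v'. u \<in> language X n \<Longrightarrow> v \<in> language X n \<Longrightarrow> v' \<in> language X n \<Longrightarrow>
      tl u = butlast v \<Longrightarrow> tl u = butlast v' \<Longrightarrow> v = v'"
  shows "complexity X m \<le> complexity X n"
proof -
  have "complexity X (n + k) \<le> complexity X n" for k
  proof (induction k)
    case (Suc k)
    have "inj_on butlast (language X (Suc (n + k)))"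
    proof (rule inj_onI)
      fix u u' assume u: "u \<in> language X (Suc (n + k))" "u' \<in> language X (Suc (n + k))"
        and eq: "butlast u = butlast u'"
      from u obtain x i y j where x: "x \<in> X" "u = window x i (Suc (n + k))"
        and y: "y \<in> X" "u' = window y j (Suc (n + k))"
        by (auto simp: language_eq_windows)
      have eq': "window x i (n + k) = window y j (n + k)" using eq x y by (simp add: butlast_window)
      then have xy: "x (i + int l) = y (j + int l)" if "l < n + k" for l
        using that by (metis window_nth)
      \<comment> \<open>The last \<open>n\<close> of the \<open>n + k\<close> common letters start
        at offset \<open>k\<close>.\<close>
      let ?i = "i + int k" and ?j = "j + int k"
      have "window x ?i n = window y ?j n"
        by (rule nth_equalityI) (use xy[of "k + _"] in \<open>auto simp: algebra_simps\<close>)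
      then have "window x (?i + 1) n = window y (?j + 1) n"
        using uniq window_step[OF \<open>1 \<le> n\<close>] window_in_language x(1) y(1) by metis
      \<comment> \<open>The last letter of the next window has offset \<open>n + k\<close>, the one
        position that \<open>eq'\<close> leaves open.\<close>
      then have "window x (?i + 1) n ! (n - 1) = window y (?j + 1) n ! (n - 1)" by simp
      then have last: "x (i + int (n + k)) = y (j + int (n + k))"
        using \<open>1 \<le> n\<close> by (simp add: algebra_simps of_nat_diff)
      show "u = u'"
      proof (rule nth_equalityI)
        fix l assume "l < length u"
        then consider "l < n + k" | "l = n + k" using x by fastforce
        then show "u ! l = u' ! l" using xy last x y by cases auto
      qed (use x y in simp)
    qed
    then have "complexity X (Suc (n + k)) = complexity X (n + k)"
      unfolding complexity_def by (metis butlast_language card_image)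
    then show ?case using Suc by simp
  qed simp
  then show ?thesis by (metis complexity_mono le_add_diff_inverse nle_le)
qed

text \<open>Neighbours are counted in all of \<open>L\<close>, not just in \<open>V\<close>. A cycle
  inside \<open>V\<close> contains a predecessor and a successor of each of its vertices, hence all
  of them in \<open>L\<close>, so its vertex set is closed in both directions, contrary to
  \<open>closed\<close>.\<close>

lemma forest_of_degree_at_most_one:
  assumes V: "V \<subseteq> L"
    and out: "\<And>u v v'. u \<in> V \<Longrightarrow> v \<in> L \<Longrightarrow> v' \<in> L \<Longrightarrow> R u v \<Longrightarrow> R u v' \<Longrightarrow> v = v'"
    and inn: "\<And>u u' v. v \<in> V \<Longrightarrow> u \<in> L \<Longrightarrow> u' \<in> L \<Longrightarrow> R u v \<Longrightarrow> R u' v \<Longrightarrow> u = u'"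
    and closed: "\<And>C. C \<noteq> {} \<Longrightarrow> C \<subseteq> V \<Longrightarrow> (\<And>u v. u \<in> C \<Longrightarrow> v \<in> L \<Longrightarrow> R u v \<Longrightarrow> v \<in> C) \<Longrightarrow>
      (\<And>u v. v \<in> C \<Longrightarrow> u \<in> L \<Longrightarrow> R u v \<Longrightarrow> u \<in> C) \<Longrightarrow> False"
  shows "directed_forest (with_proj (rel_digraph V R))"
proof -
  have no_cycle: False if "vs \<noteq> []" "set vs \<subseteq> V"
    and nb: "\<And>v. v \<in> set vs \<Longrightarrow> \<exists>a\<in>set vs. \<exists>b\<in>set vs. R a v \<and> R v b" for vs
  proof (rule closed[of "set vs"])
    fix u v assume "u \<in> set vs" "v \<in> L" "R u v"
    then show "v \<in> set vs" using nb[of u] out[of u v] that(2) V by blast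
  next
    fix u v assume "v \<in> set vs" "u \<in> L" "R u v"
    then show "u \<in> set vs" using nb[of v] inn[of v u] that(2) V by blast
  qed (use that in auto)
  have False if "cyclic_list R vs" "set vs \<subseteq> V" for vs
    by (rule no_cycle[of vs]) (use that in \<open>auto simp: cyclic_list_def elim: cyclic_list_neighbours[OF that(1)]\<close>)
  moreover have False if c: "cyclic_list (symclp R) vs" and sub: "set vs \<subseteq> V" and len: "3 \<le> length vs" for vs
  proof (rule no_cycle[of vs])
    fix v assume v: "v \<in> set vs"
    obtain a b where ab: "a \<in> set vs" "b \<in> set vs" "symclp R a v" "symclp R v b" "a \<noteq> b"
      using cyclic_list_neighbours[OF c v] len by metis
    have "a \<in> L" "b \<in> L" "v \<in> V" using ab v sub V by auto
    \<comment> \<open>The two different neighbours of \<open>v\<close> on an undirected cycle are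
      not both successors and not both predecessors, so one is of each kind.\<close>
    then have "\<not> (R v a \<and> R v b)" "\<not> (R a v \<and> R b v)" using out inn ab(5) by blast+
    then show "\<exists>a\<in>set vs. \<exists>b\<in>set vs. R a v \<and> R v b" using ab by (auto simp: symclp_def)
  qed (use c sub in \<open>auto simp: cyclic_list_def\<close>)
  ultimately show ?thesis unfolding directed_forest_rel_digraph_iff by blast
qed

lemma deconnecting_set_exists:
  fixes X :: "(int \<Rightarrow> 'a::finite) set"
  assumes X: "minimal_subshift X" and unbounded: "\<And>B. \<exists>m. complexity X m > B"
    and incr: "complexity X (Suc n) \<le> complexity X n + D"
  shows "\<exists>V'. V' \<subseteq> language X (Suc n) \<and> card V' \<le> 2 * CARD('a) * D \<and>
    directed_forest (with_proj (rel_digraph (language X (Suc n) - V') (\<lambda>u v. tl u = butlast v)))"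
proof -
  let ?L = "language X (Suc n)"
  \<comment> \<open>\<open>RS\<close> and \<open>LS\<close> are the right and left special words of
    length \<open>n\<close>. An arc needs only matching overlap, so the successors of
    \<open>u\<close> are governed by \<open>tl u\<close> and its predecessors by
    \<open>butlast u\<close>.\<close>
  define RS where "RS = {w. \<exists>v\<in>?L. \<exists>v'\<in>?L. v \<noteq> v' \<and> butlast v = w \<and> butlast v' = w}"
  define LS where "LS = {w. \<exists>v\<in>?L. \<exists>v'\<in>?L. v \<noteq> v' \<and> tl v = w \<and> tl v' = w}"
  let ?V1 = "{u \<in> ?L. tl u \<in> RS}" and ?V2 = "{u \<in> ?L. butlast u \<in> LS}"
  have "card RS \<le> D" "card LS \<le> D"
    using card_multiple_fibres[of ?L butlast] card_multiple_fibres[of ?L tl] incr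
    by (simp_all add: butlast_language tl_language complexity_def RS_def LS_def)
  moreover have nonempty: "u \<noteq> []" if "u \<in> ?L" for u using length_language[OF that] by auto
  have "RS \<subseteq> butlast ` ?L" "LS \<subseteq> tl ` ?L" by (auto simp: RS_def LS_def)
  then have "finite RS" "finite LS" using finite_surj[OF finite_language] by blast+
  have "card ?V1 \<le> CARD('a) * card RS"
    by (rule card_tl_vimage_le) (use \<open>finite RS\<close> nonempty in auto)
  moreover have "card ?V2 \<le> CARD('a) * card LS"
    by (rule card_butlast_vimage_le) (use \<open>finite LS\<close> nonempty in auto)
  moreover have "card (?V1 \<union> ?V2) \<le> card ?V1 + card ?V2" by (rule card_Un_le)
  ultimately have "card (?V1 \<union> ?V2) \<le> CARD('a) * D + CARD('a) * D"
    by (meson add_mono le_trans mult_le_mono2)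
  then have card: "card (?V1 \<union> ?V2) \<le> 2 * CARD('a) * D" by simp
  let ?V = "?L - (?V1 \<union> ?V2)"
  have out: "v = v'" if "u \<in> ?V" "v \<in> ?L" "v' \<in> ?L" "tl u = butlast v" "tl u = butlast v'" for u v v'
  proof -
    have "tl u \<notin> RS" using that(1) by simp
    then show ?thesis using that(2-5) unfolding RS_def by auto
  qed
  have inn: "u = u'" if "v \<in> ?V" "u \<in> ?L" "u' \<in> ?L" "tl u = butlast v" "tl u' = butlast v" for u u' v
  proof -
    have "tl u \<notin> LS" using that(1,4) by simp
    then show ?thesis using that(2-5) unfolding LS_def by auto
  qed
  have "directed_forest (with_proj (rel_digraph ?V (\<lambda>u v. tl u = butlast v)))"
  proof (rule forest_of_degree_at_most_one[OF _ out inn])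
    fix C assume C: "C \<noteq> {}" "C \<subseteq> ?V"
      and cl: "\<And>u v. u \<in> C \<Longrightarrow> v \<in> ?L \<Longrightarrow> tl u = butlast v \<Longrightarrow> v \<in> C"
        "\<And>u v. v \<in> C \<Longrightarrow> u \<in> ?L \<Longrightarrow> tl u = butlast v \<Longrightarrow> u \<in> C"
    have "C \<subseteq> ?L" using C(2) by blast
    have "C = ?L" by (rule minimal_closed_set_of_words[OF X _ \<open>C \<subseteq> ?L\<close> C(1) cl]) simp_all
    \<comment> \<open>If a closed set fills the whole language, no word was deleted, so successors
      are unique everywhere and the complexity is bounded.\<close>
    then have "?L \<subseteq> ?V" using C(2) by simp
    then have "u \<in> ?V" if "u \<in> ?L" for u using that by (rule subsetD)
    then have "complexity X m \<le> complexity X (Suc n)" for m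
      by (intro complexity_bounded_of_unique_successors) (simp, rule out)
    then show False using unbounded[of "complexity X (Suc n)"] by (meson not_le)
  qed (rule Diff_subset)
  with card show ?thesis by (intro exI[of _ "?V1 \<union> ?V2"]) auto
qed

lemma strongly_deconnectable_iff:
  "strongly_deconnectable K (X :: (int \<Rightarrow> 'a::finite) set) \<longleftrightarrow>
     (\<exists>(N :: nat \<Rightarrow> nat) (K' :: real). strict_mono N \<and> (\<forall>i. 2 \<le> N i) \<and> 1 \<le> K' \<and>
        (\<forall>i. \<exists>V'. V' \<subseteq> language X (N i) \<and> card V' \<le> K \<and>
           (\<forall>vs. vs \<noteq> [] \<and> set vs \<subseteq> language X (N i) - V' \<and> distinct vs \<and>
              successively (\<lambda>u v. tl u = butlast v) vs \<longrightarrow> real (length vs - 1) \<le> K' * real (N i)) \<and>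
           directed_forest (with_proj (rel_digraph (language X (N i) - V') (\<lambda>u v. tl u = butlast v)))))"
proof -
  have fin: "finite V' \<longleftrightarrow> True" if "V' \<subseteq> language X n" for V' n
    using that finite_subset by blast
  show ?thesis
    unfolding strongly_deconnectable_def Let_def induce_rauzy_graph[OF Diff_subset]
      apath_rel_digraph_iff[where Q = "\<lambda>l. real l \<le> c" for c]
    by (simp add: fin cong: conj_cong)
qed

lemma strongly_deconnectable_if_non_superlinear:
  fixes X :: "(int \<Rightarrow> 'a::finite) set"
  assumes X: "minimal_subshift X" and "non_superlinear_complexity X"
  shows "\<exists>K\<ge>1. strongly_deconnectable K X"
proof (cases "\<exists>B. \<forall>m. complexity X m \<le> B")
  case True
  then obtain B where B: "\<And>m. complexity X m \<le> B" by blast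
  have "strongly_deconnectable (max 1 B) X"
    unfolding strongly_deconnectable_iff
  proof (intro exI[of _ "\<lambda>i. i + 2"] exI[of _ 1] conjI allI)
    fix i
    show "\<exists>V'. V' \<subseteq> language X (i + 2) \<and> card V' \<le> max 1 B \<and>
       (\<forall>vs. vs \<noteq> [] \<and> set vs \<subseteq> language X (i + 2) - V' \<and> distinct vs \<and>
          successively (\<lambda>u v. tl u = butlast v) vs \<longrightarrow> real (length vs - 1) \<le> 1 * real (i + 2)) \<and>
       directed_forest (with_proj (rel_digraph (language X (i + 2) - V') (\<lambda>u v. tl u = butlast v)))"
      using B[of "i + 2"]
      \<comment> \<open>Deleting all words, at most \<open>B\<close> in number, leaves the empty
        graph.\<close>
      by (intro exI[of _ "language X (i + 2)"])
        (auto simp: complexity_def directed_forest_rel_digraph_iff cyclic_list_def)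
  qed (auto simp: strict_mono_def)
  then show ?thesis by (meson max.cobounded1)
next
  case False
  then have unbounded: "\<And>B. \<exists>m. complexity X m > B" by (meson not_le)
  obtain C :: nat where C: "C \<ge> 1" "\<And>m. \<exists>n\<ge>m. complexity X n \<le> C * n"
    using assms(2) unfolding non_superlinear_complexity_iff by blast
  define S where "S = {n. complexity X (Suc n) \<le> complexity X n + 2 * C \<and>
    complexity X (Suc n) \<le> 2 * C * Suc n}"
  have "mono (complexity X)" by (simp add: monoI complexity_mono)
  \<comment> \<open>Restricting to \<open>{1..}\<close> makes every level \<open>Suc n\<close> at
    least 2.\<close>
  then have "infinite (S \<inter> {1..})"
    unfolding infinite_nat_iff_unbounded_le
    using small_increment[OF _ C(2)] by (auto simp: S_def) (metis Suc_eq_plus1_left add_leE)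
  define N where "N i = Suc (enumerate (S \<inter> {1..}) i)" for i
  have N: "\<exists>n. N i = Suc n \<and> n \<in> S \<and> 1 \<le> n" for i
    using enumerate_in_set[OF \<open>infinite (S \<inter> {1..})\<close>] by (auto simp: N_def)
  have "strongly_deconnectable (2 * CARD('a) * (2 * C)) X"
    unfolding strongly_deconnectable_iff
  proof (intro exI[of _ N] exI[of _ "real (2 * C)"] conjI allI)
    show "strict_mono N"
      using strict_mono_enumerate[OF \<open>infinite (S \<inter> {1..})\<close>] by (auto simp: N_def strict_mono_def)
    fix i
    obtain n where n: "N i = Suc n" "n \<in> S" "1 \<le> n" using N by blast
    then show "2 \<le> N i" by simp
    obtain V' where V': "V' \<subseteq> language X (N i)" "card V' \<le> 2 * CARD('a) * (2 * C)"
      "directed_forest (with_proj (rel_digraph (language X (N i) - V') (\<lambda>u v. tl u = butlast v)))"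
      using deconnecting_set_exists[OF X unbounded, of n "2 * C"] n by (auto simp: S_def)
    \<comment> \<open>A path has distinct vertices, so the linear bound on the complexity at this
      level bounds its length.\<close>
    have "real (length vs - 1) \<le> real (2 * C) * real (N i)"
      if "set vs \<subseteq> language X (N i) - V'" "distinct vs" for vs
    proof -
      have "length vs = card (set vs)" using that by (simp add: distinct_card)
      also have "\<dots> \<le> complexity X (N i)"
        unfolding complexity_def using that by (intro card_mono) auto
      also have "\<dots> \<le> 2 * C * N i" using n by (simp add: S_def)
      finally have "length vs - 1 \<le> 2 * C * N i" by simp
      then show ?thesis by (metis of_nat_le_iff of_nat_mult)
    qed
    with V' show "\<exists>V'. V' \<subseteq> language X (N i) \<and> card V' \<le> 2 * CARD('a) * (2 * C) \<and>
       (\<forall>vs. vs \<noteq> [] \<and> set vs \<subseteq> language X (N i) - V' \<and> distinct vs \<and>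
          successively (\<lambda>u v. tl u = butlast v) vs \<longrightarrow> real (length vs - 1) \<le> real (2 * C) * real (N i)) \<and>
       directed_forest (with_proj (rel_digraph (language X (N i) - V') (\<lambda>u v. tl u = butlast v)))"
      by (intro exI[of _ V']) auto
  qed (use C in auto)
  moreover have "1 \<le> 2 * CARD('a) * (2 * C)" using C(1) by (simp add: Suc_le_eq)
  ultimately show ?thesis by blast
qed

section \<open>Counting walks in the forest\<close>

text \<open>Walks in a directed forest repeat no vertex and are determined by their ends, so the
  union is empty or the vertex set of a single path.\<close>

lemma card_union_unique_walks:
  assumes forest: "directed_forest (with_proj (rel_digraph V R))"
    and len: "\<And>vs. vs \<noteq> [] \<Longrightarrow> set vs \<subseteq> V \<Longrightarrow> distinct vs \<Longrightarrow> successively R vs \<Longrightarrow> length vs \<le> B"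
  shows "finite (\<Union>{set vs | vs. vs \<noteq> [] \<and> set vs \<subseteq> V \<and> successively R vs \<and> hd vs = s \<and> last vs = e}) \<and>
    card (\<Union>{set vs | vs. vs \<noteq> [] \<and> set vs \<subseteq> V \<and> successively R vs \<and> hd vs = s \<and> last vs = e}) \<le> B"
    (is "finite (\<Union>?W) \<and> card (\<Union>?W) \<le> B")
proof (cases "?W = {}")
  case False
  then obtain xs where xs: "xs \<noteq> []" "set xs \<subseteq> V" "successively R xs" "hd xs = s" "last xs = e" by blast
  have cyc: "\<not> cyclic_list R vs" if "set vs \<subseteq> V" for vs
    using forest that unfolding directed_forest_rel_digraph_iff by blast
  have dist: "distinct vs" if "set vs \<subseteq> V" "successively R vs" for vs
    using not_distinct_walk_imp_cyclic_list[OF that(2)] that(1) cyc by (meson subset_trans)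
  have "ys = xs" if "ys \<noteq> []" "set ys \<subseteq> V" "successively R ys" "hd ys = s" "last ys = e" for ys
  proof (rule unique_walk[where V = V and R = R])
    fix zs assume "cyclic_list (symclp R) zs" "set zs \<subseteq> V"
    then show "length zs < 3" using forest unfolding directed_forest_rel_digraph_iff by fastforce
  qed (use that xs dist in auto)
  then have "?W = {set xs}" using xs by blast
  moreover have "card (set xs) \<le> B" using len[of xs] xs dist by (simp add: distinct_card)
  ultimately show ?thesis by simp
next
  case True
  show ?thesis unfolding True by simp
qed

lemma successively_map_upto:
  assumes "\<And>k. i \<le> k \<Longrightarrow> k \<le> j \<Longrightarrow> R (w k) (w (k + 1))"
  shows "successively R (map w [i..j])"
proof (cases "i \<le> j")
  case True
  then show ?thesis using assms
  proof (induction j rule: int_ge_induct)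
    case (step j)
    have "[i..j + 1] = [i..j] @ [j + 1]" using step.hyps by (simp add: upto_rec2)
    moreover have "successively R (map w [i..j])" using step by simp
    moreover have "last (map w [i..j]) = w j" using step.hyps by (simp add: last_map upto_rec2)
    ultimately show ?case using step by (simp add: successively_append_iff)
  qed simp
qed simp

text \<open>Long stretches avoiding \<open>D\<close> are impossible, so the walk meets
  \<open>D\<close> on both sides of position \<open>i\<close>. The segment strictly between the
  nearest visits is the walk sought.\<close>

lemma biinfinite_walk_covered:
  fixes w :: "int \<Rightarrow> 'v"
  assumes walk: "\<And>k. R (w k) (w (k + 1))" and L: "\<And>k. w k \<in> L"
    and len: "\<And>vs. vs \<noteq> [] \<Longrightarrow> set vs \<subseteq> L - D \<Longrightarrow> successively R vs \<Longrightarrow> length vs \<le> B"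
    and i: "w i \<notin> D"
  obtains vs where "vs \<noteq> []" "set vs \<subseteq> L - D" "successively R vs" "w i \<in> set vs"
    "\<exists>d\<in>D. R d (hd vs)" "\<exists>d\<in>D. R (last vs) d"
proof -
  \<comment> \<open>The interval has \<open>B + 1\<close> positions, one more than a walk outside
    \<open>D\<close> can have vertices.\<close>
  have hit: "\<exists>k\<in>{a..a + int B}. w k \<in> D" for a
  proof (rule ccontr)
    assume "\<not> ?thesis"
    then have "set (map w [a..a + int B]) \<subseteq> L - D" using L by auto
    then have "length (map w [a..a + int B]) \<le> B" by (intro len successively_map_upto walk) auto
    then show False by simp
  qed
  define p where "p = (LEAST p. w (i + int p) \<in> D)"
  define q where "q = (LEAST q. w (i - int q) \<in> D)"
  obtain k where "k \<in> {i..i + int B}" "w k \<in> D" using hit by blast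
  then have "w (i + int (nat (k - i))) \<in> D" by simp
  then have p: "w (i + int p) \<in> D" unfolding p_def by (rule LeastI)
  obtain k where "k \<in> {i - int B..i - int B + int B}" "w k \<in> D" using hit by blast
  then have "w (i - int (nat (i - k))) \<in> D" by simp
  then have q: "w (i - int q) \<in> D" unfolding q_def by (rule LeastI)
  have p': "w (i + int r) \<notin> D" if "r < p" for r using not_less_Least that unfolding p_def by blast
  have q': "w (i - int r) \<notin> D" if "r < q" for r using not_less_Least that unfolding q_def by blast
  have "p \<noteq> 0" "q \<noteq> 0" using p q i by (metis add.right_neutral diff_zero of_nat_0)+
  \<comment> \<open>Both endpoints in \<open>D\<close> are left out; position \<open>i\<close>
    remains because \<open>p\<close> and \<open>q\<close> are positive.\<close>
  let ?I = "[i - int q + 1..i + int p - 1]"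
  have I: "?I \<noteq> []" "i \<in> set ?I" using \<open>p \<noteq> 0\<close> \<open>q \<noteq> 0\<close> by auto
  have out: "w k \<notin> D" if "k \<in> set ?I" for k
  proof (cases "i \<le> k")
    case True
    moreover have "nat (k - i) < p" using that True by auto
    ultimately show ?thesis using p'[of "nat (k - i)"] by simp
  next
    case False
    moreover have "nat (i - k) < q" using that False by auto
    ultimately show ?thesis using q'[of "nat (i - k)"] by simp
  qed
  have "i - int q + 1 \<le> i + int p - 1" using I by simp
  note ends = upto_rec1[OF this] upto_rec2[OF this]
  have "hd ?I = i - int q + 1" by (simp only: ends(1) list.sel)
  moreover have "last ?I = i + int p - 1" by (simp only: ends(2) last_snoc)
  ultimately have "hd (map w ?I) = w (i - int q + 1)" "last (map w ?I) = w (i + int p - 1)"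
    using I by (simp_all add: hd_map last_map)
  moreover have "R (w (i - int q)) (w (i - int q + 1))" "R (w (i + int p - 1)) (w (i + int p))"
    using walk[of "i - int q"] walk[of "i + int p - 1"] by simp_all
  ultimately have "\<exists>d\<in>D. R d (hd (map w ?I))" "\<exists>d\<in>D. R (last (map w ?I)) d"
    using p q by (auto simp del: upto.simps)
  moreover have "set (map w ?I) \<subseteq> L - D" using L out by auto
  moreover have "successively R (map w ?I)" by (rule successively_map_upto) (rule walk)
  ultimately show ?thesis using that[of "map w ?I"] I by auto
qed

text \<open>Each word outside \<open>D\<close> lies on a walk from a successor of \<open>D\<close>
  to a predecessor of \<open>D\<close>. There are at most \<open>CARD('a) * K\<close> candidates for
  each end, and each pair of ends accounts for at most \<open>B\<close> words.\<close>

lemma complexity_le_of_forest: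
  fixes X :: "(int \<Rightarrow> 'a::finite) set"
  assumes "1 \<le> n" and D: "D \<subseteq> language X n" "card D \<le> K"
    and forest: "directed_forest (with_proj (rel_digraph (language X n - D) (\<lambda>u v. tl u = butlast v)))"
    and len: "\<And>vs. vs \<noteq> [] \<Longrightarrow> set vs \<subseteq> language X n - D \<Longrightarrow> distinct vs \<Longrightarrow>
      successively (\<lambda>u v. tl u = butlast v) vs \<Longrightarrow> length vs \<le> B"
  shows "complexity X n \<le> K + (CARD('a) * K)\<^sup>2 * B"
proof -
  let ?L = "language X n" and ?R = "\<lambda>u v :: 'a list. tl u = butlast v"
  let ?S = "{v \<in> ?L. \<exists>d\<in>D. ?R d v}" and ?E = "{u \<in> ?L. \<exists>d\<in>D. ?R u d}"
  define W where "W s e = \<Union>{set vs | vs. vs \<noteq> [] \<and> set vs \<subseteq> ?L - D \<and> successively ?R vs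
    \<and> hd vs = s \<and> last vs = e}" for s e
  have W: "finite (W s e)" "card (W s e) \<le> B" for s e
    using card_union_unique_walks[OF forest len, of s e] unfolding W_def by auto
  have [simp]: "finite D" using D(1) finite_subset by blast
  have nonempty: "u \<noteq> []" if "u \<in> ?L" for u using length_language[OF that] assms(1) by auto
  have "card ?S \<le> CARD('a) * card (tl ` D)"
    by (rule card_butlast_vimage_le) (simp, use nonempty in force)
  also have "\<dots> \<le> CARD('a) * K" using D(2) card_image_le[of D tl] by simp
  finally have S: "card ?S \<le> CARD('a) * K" .
  have "card ?E \<le> CARD('a) * card (butlast ` D)"
    by (rule card_tl_vimage_le) (simp, use nonempty in force)
  also have "\<dots> \<le> CARD('a) * K" using D(2) card_image_le[of D butlast] by simp
  finally have E: "card ?E \<le> CARD('a) * K" .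
  have dist: "distinct vs" if "set vs \<subseteq> ?L - D" "successively ?R vs" for vs
    using not_distinct_walk_imp_cyclic_list[OF that(2)] that(1) forest
    unfolding directed_forest_rel_digraph_iff by (meson subset_trans)
  have "?L \<subseteq> D \<union> (\<Union>(s, e)\<in>?S \<times> ?E. W s e)"
  proof
    fix u assume "u \<in> ?L"
    then obtain x i where x: "x \<in> X" "u = window x i n" by (auto simp: language_eq_windows)
    show "u \<in> D \<union> (\<Union>(s, e)\<in>?S \<times> ?E. W s e)"
    proof (cases "u \<in> D")
      case False
      have len': "length vs \<le> B" if "vs \<noteq> []" "set vs \<subseteq> ?L - D" "successively ?R vs" for vs
        using len that dist by blast
      have "window x i n \<notin> D" using False x(2) by simp
      from biinfinite_walk_covered[of ?R "\<lambda>k. window x k n" ?L D B i,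
          OF window_step[OF assms(1)] window_in_language[OF x(1)] len' this]
      obtain vs where vs: "vs \<noteq> []" "set vs \<subseteq> ?L - D" "successively ?R vs" "u \<in> set vs"
        "\<exists>d\<in>D. ?R d (hd vs)" "\<exists>d\<in>D. ?R (last vs) d"
        unfolding x(2) by blast
      have "hd vs \<in> ?L" "last vs \<in> ?L" using vs(1,2) by (meson DiffD1 hd_in_set last_in_set subsetD)+
      moreover have "u \<in> W (hd vs) (last vs)" using vs unfolding W_def by blast
      ultimately show ?thesis using vs(5,6) by blast
    qed simp
  qed
  then have "card ?L \<le> card (D \<union> (\<Union>(s, e)\<in>?S \<times> ?E. W s e))"
    by (intro card_mono) (auto simp: W)
  also have "\<dots> \<le> card D + card (\<Union>(s, e)\<in>?S \<times> ?E. W s e)" by (rule card_Un_le)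
  also have "card (\<Union>(s, e)\<in>?S \<times> ?E. W s e) \<le> (\<Sum>(s, e)\<in>?S \<times> ?E. card (W s e))"
    using card_UN_le[of "?S \<times> ?E" "\<lambda>(s, e). W s e"] by (simp add: case_prod_unfold)
  also have "\<dots> \<le> card (?S \<times> ?E) * B"
    using sum_bounded_above[of "?S \<times> ?E" "\<lambda>(s, e). card (W s e)" B] W(2) by auto
  also have "\<dots> \<le> (CARD('a) * K)\<^sup>2 * B"
    using mult_le_mono[OF S E] by (simp add: card_cartesian_product power2_eq_square)
  finally show ?thesis using D(2) unfolding complexity_def by linarith
qed

lemma non_superlinear_if_strongly_deconnectable:
  fixes X :: "(int \<Rightarrow> 'a::finite) set"
  assumes "strongly_deconnectable K X"
  shows "non_superlinear_complexity X"
proof -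
  obtain N :: "nat \<Rightarrow> nat" and K' :: real where N: "strict_mono N" "\<And>i. 2 \<le> N i" and "1 \<le> K'"
    and dec: "\<And>i. \<exists>V'. V' \<subseteq> language X (N i) \<and> card V' \<le> K \<and>
      (\<forall>vs. vs \<noteq> [] \<and> set vs \<subseteq> language X (N i) - V' \<and> distinct vs \<and>
         successively (\<lambda>u v. tl u = butlast v) vs \<longrightarrow> real (length vs - 1) \<le> K' * real (N i)) \<and>
      directed_forest (with_proj (rel_digraph (language X (N i) - V') (\<lambda>u v. tl u = butlast v)))"
    using assms unfolding strongly_deconnectable_iff by blast
  define k where "k = nat \<lceil>K'\<rceil>"
  \<comment> \<open>\<open>Suc\<close> makes the constant positive, and \<open>k + 1\<close> absorbs
    the extra vertex that a path has beyond its number of arcs.\<close>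
  define C where "C = Suc (K + (CARD('a) * K)\<^sup>2 * (k + 1))"
  have bound: "complexity X (N i) \<le> C * N i" for i
  proof -
    obtain V' where V': "V' \<subseteq> language X (N i)" "card V' \<le> K"
      and len: "\<And>vs. vs \<noteq> [] \<Longrightarrow> set vs \<subseteq> language X (N i) - V' \<Longrightarrow> distinct vs \<Longrightarrow>
         successively (\<lambda>u v. tl u = butlast v) vs \<Longrightarrow> real (length vs - 1) \<le> K' * real (N i)"
      and forest: "directed_forest (with_proj (rel_digraph (language X (N i) - V') (\<lambda>u v. tl u = butlast v)))"
      using dec[of i] by blast
    have "K' \<le> real k" unfolding k_def by linarith
    then have "K' * real (N i) \<le> real (k * N i)" by (simp add: mult_right_mono)
    then have len': "length vs \<le> k * N i + 1"
      if "vs \<noteq> []" "set vs \<subseteq> language X (N i) - V'" "distinct vs"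
        "successively (\<lambda>u v. tl u = butlast v) vs" for vs
      using len[OF that] by linarith
    have "complexity X (N i) \<le> K + (CARD('a) * K)\<^sup>2 * (k * N i + 1)"
      using N(2)[of i] by (intro complexity_le_of_forest[OF _ V' forest len']) auto
    also have "\<dots> \<le> K * N i + (CARD('a) * K)\<^sup>2 * ((k + 1) * N i)"
      using N(2)[of i] by (intro add_mono mult_le_mono2) auto
    also have "\<dots> \<le> C * N i" by (simp add: C_def algebra_simps)
    finally show ?thesis .
  qed
  \<comment> \<open>A strictly increasing sequence of naturals satisfies
    \<open>N m >= m\<close>.\<close>
  have "\<exists>n\<ge>m. complexity X n \<le> C * n" for m
    using bound[of m] strict_mono_imp_increasing[OF N(1), of m] by blast
  then show ?thesis unfolding non_superlinear_complexity_iff by (intro exI[of _ C]) (auto simp: C_def)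
qed

theorem proposition5p3:
  fixes X :: "(int \<Rightarrow> 'a::finite) set"
  assumes "minimal_subshift X"
  shows "non_superlinear_complexity X \<longleftrightarrow> (\<exists>K\<ge>1. strongly_deconnectable K X)"
  using strongly_deconnectable_if_non_superlinear[OF assms]
    non_superlinear_if_strongly_deconnectable by blast

end
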